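(* Fix $\rho>1$. For each horizon $n$, consider a two-armed bandit instance with arm means $\mu_1=\mu_1^{(n)}$, $\mu_2=\mu_2^{(n)}$ and gap $\Delta=\Delta_n=|\mu_1^{(n)}-\mu_2^{(n)}|$, played by the canonical UCB policy with exploration coefficient $\rho$. Let $i^\ast=i^\ast_n\in\arg\max\{\mu_i^{(n)}: i=1,2\}$, with ties broken arbitrarily, and let $N_{i^\ast}(n)$ be the number of pulls of arm $i^\ast$ up to and including time $n$ in the $n$-th instance. Then, as $n\to\infty$: (I) ("Large gap") If $\Delta_n=\omega\left(\sqrt{\frac{\log n}{n}}\right)$, then $\frac{N_{i^\ast}(n)}{n}\xrightarrow{p}1$. (II) ("Small gap") If $\Delta_n=o\left(\sqrt{\frac{\log n}{n}}\right)$, then $\frac{N_{i^\ast}(n)}{n}\xrightarrow{p}\frac12$. (III) ("Moderate gap") If $\Delta_n\sim\sqrt{\frac{\theta\log n}{n}}$ for some fixed $\theta\geqslant 0$, meaning $\Delta_n\sqrt{n/\log n}\to\sqrt{\theta}$, then $\frac{N_{i^\ast}(n)}{n}\xrightarrow{p}\lambda^\ast_\rho(\theta)$, where $\lambda^\ast_\rho(\theta)$ is the unique solution $\lambda\in(0,1)$ of $$\frac{1}{\sqrt{1-\lambda}}-\frac{1}{\sqrt{\lambda}}=\sqrt{\frac{\theta}{\rho}}.$$ Moreover, $\theta\mapsto\lambda^\ast_\rho(\theta)$ is monotone increasing on $[0,\infty)$, with $\lambda^\ast_\rho(0)=1/2$ and $\lambda^\ast_\rho(\theta)\to1$ as $\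theta\to\infty$.
   Context: Model. There are two arms, indexed by $\{1,2\}$. Arm $i$ has a reward distribution $\mathcal{P}_i$ supported on $[0,1]$ with mean $\mu_i$. The reward from the $j$-th pull of arm $i$ is $X_{i,j}$; the variables $(X_{i,j})_{j\geqslant1}$ are i.i.d. with law $\mathcal{P}_i$, and the two sequences are independent of each other. $N_i(t)$ denotes the number of pulls of arm $i$ up to and including time $t$. The instance $(\mathcal{P}_1,\mathcal{P}_2)$ may depend on the horizon $n$ (so that the gap $\Delta=|\mu_1-\mu_2|$ may scale with $n$); the asymptotic statements concern the resulting sequence of instances indexed by $n$. Canonical UCB policy with exploration coefficient $\rho$. At times $t=1,2$ play each arm once. At each time $t\geqslant3$ play an arm $$\pi_t\in\arg\max_{i\in\{1,2\}}\left(\bar X_i(t-1)+\sqrt{\frac{\rho\log(t-1)}{N_i(t-1)}}\right),\qquad \bar X_i(t-1)=\frac{\sum_{j=1}^{N_i(t-1)}X_{i,j}}{N_i(t-1)},$$ where ties in the argmax are broken by an arbitrary non-anticipating rule (based only on past observations and possibly independent randomization). Notation. $f(n)=o(g(n))$, equivalently $g(n)=\omega(f(n))$, means $\lim_{n\to\infty}f(n)/g(n)=0$. $\xrightarrow{p}$ denotes convergence in probability. *)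

theory Defs
  imports "HOL-Probability.Probability" "HOL-Library.Landau_Symbols"
begin

text \<open>
  Arms are the natural numbers 1 and 2. \<open>P i\<close> is the reward law of arm \<open>i\<close> and
  \<open>X i j\<close>, for \<open>j \<ge> 1\<close>, is the reward of the \<open>j\<close>-th pull of arm \<open>i\<close>. Independence over the
  whole index set expresses at once that each sequence is independent and that the two sequences
  are independent of each other. That each \<open>P i\<close> is a Borel probability measure follows from
  \<open>law\<close>.
\<close>

locale two_armed_bandit = prob_space M
  for M :: "'a measure" +
  fixes P :: "nat \<Rightarrow> real measure"
    and X :: "nat \<Rightarrow> nat \<Rightarrow> 'a \<Rightarrow> real"
  assumes supported: "\<And>i. i \<in> {1, 2} \<Longrightarrow> AE x in P i. x \<in> {0..1}"
    and indep: "indep_vars (\<lambda>_. borel) (\<lambda>(i, j). X i j) ({1, 2} \<times> {1..})"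
    and law: "\<And>i j. i \<in> {1, 2} \<Longrightarrow> 1 \<le> j \<Longrightarrow> distr M borel (X i j) = P i"

definition arm_mean :: "(nat \<Rightarrow> real measure) \<Rightarrow> nat \<Rightarrow> real" where
  "arm_mean P i = (\<integral>x. x \<partial>P i)"

definition gap :: "(nat \<Rightarrow> real measure) \<Rightarrow> real" where
  "gap P = \<bar>arm_mean P 1 - arm_mean P 2\<bar>"

text \<open>\<open>\<pi> t \<omega>\<close> is the arm played at time \<open>t \<ge> 1\<close>.\<close>

definition pulls :: "(nat \<Rightarrow> 'a \<Rightarrow> nat) \<Rightarrow> nat \<Rightarrow> nat \<Rightarrow> 'a \<Rightarrow> nat" where
  "pulls \<pi> i t \<omega> = card {s \<in> {1..t}. \<pi> s \<omega> = i}"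

definition empirical_mean ::
  "(nat \<Rightarrow> nat \<Rightarrow> 'a \<Rightarrow> real) \<Rightarrow> (nat \<Rightarrow> 'a \<Rightarrow> nat) \<Rightarrow> nat \<Rightarrow> nat \<Rightarrow> 'a \<Rightarrow> real" where
  "empirical_mean X \<pi> i t \<omega> = (\<Sum>j = 1..pulls \<pi> i t \<omega>. X i j \<omega>) / real (pulls \<pi> i t \<omega>)"

definition ucb_index ::
  "real \<Rightarrow> (nat \<Rightarrow> nat \<Rightarrow> 'a \<Rightarrow> real) \<Rightarrow> (nat \<Rightarrow> 'a \<Rightarrow> nat) \<Rightarrow> nat \<Rightarrow> nat \<Rightarrow> 'a \<Rightarrow> real" where
  "ucb_index \<rho> X \<pi> i t \<omega> =
     empirical_mean X \<pi> i t \<omega> + sqrt (\<rho> * ln (real t) / real (pulls \<pi> i t \<omega>))"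

definition observed_reward ::
  "(nat \<Rightarrow> nat \<Rightarrow> 'a \<Rightarrow> real) \<Rightarrow> (nat \<Rightarrow> 'a \<Rightarrow> nat) \<Rightarrow> nat \<Rightarrow> 'a \<Rightarrow> real" where
  "observed_reward X \<pi> t \<omega> = X (\<pi> t \<omega>) (pulls \<pi> (\<pi> t \<omega>) t \<omega>) \<omega>"

text \<open>
  The sigma-algebra of the information available just before time \<open>t\<close>: it is generated by the
  external randomization \<open>U\<close> (an element of an arbitrary measurable space \<open>S\<close>) and by the arms
  played and the rewards observed at times \<open>1, \<dots>, t - 1\<close>.
\<close>

definition past ::
  "'a measure \<Rightarrow> 'u measure \<Rightarrow> ('a \<Rightarrow> 'u) \<Rightarrow> (nat \<Rightarrow> nat \<Rightarrow> 'a \<Rightarrow> real) \<Rightarrow>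
     (nat \<Rightarrow> 'a \<Rightarrow> nat) \<Rightarrow> nat \<Rightarrow> 'a measure" where
  "past M S U X \<pi> t =
     vimage_algebra (space M)
       (\<lambda>\<omega>. (U \<omega>, \<lambda>s\<in>{1..<t}. (\<pi> s \<omega>, observed_reward X \<pi> s \<omega>)))
       (S \<Otimes>\<^sub>M PiM {1..<t} (\<lambda>_. count_space UNIV \<Otimes>\<^sub>M borel))"

text \<open>
  The tie-breaking rule is not given explicitly: \<open>\<pi>\<close> may be any process that plays a maximizer
  of the index and whose decision at each time is measurable with respect to the past. The
  independence of \<open>U\<close> and the rewards is stated through the generated sigma-algebras because
  \<open>indep_var\<close> needs both variables to have the same range type.
\<close>

locale canonical_ucb = two_armed_bandit M P X
  for M :: "'a measure" and P :: "nat \<Rightarrow> real measure" and X :: "nat \<Rightarrow> nat \<Rightarrow> 'a \<Rightarrow> real" +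
  fixes \<rho> :: real
    and S :: "'u measure"
    and U :: "'a \<Rightarrow> 'u"
    and \<pi> :: "nat \<Rightarrow> 'a \<Rightarrow> nat"
  assumes randomization: "random_variable S U"
    and randomization_indep:
      "indep_set (sets (vimage_algebra (space M) U S))
         (sets (vimage_algebra (space M)
            (\<lambda>\<omega>. \<lambda>(i, j)\<in>{1, 2} \<times> {1..}. X i j \<omega>)
            (PiM ({1, 2} \<times> {1..}) (\<lambda>_. borel))))"
    and arm: "\<And>t \<omega>. 1 \<le> t \<Longrightarrow> \<omega> \<in> space M \<Longrightarrow> \<pi> t \<omega> \<in> {1, 2}"
    and initial: "\<And>\<omega>. \<omega> \<in> space M \<Longrightarrow> \<pi> 1 \<omega> \<noteq> \<pi> 2 \<omega>"
    and ucb_rule: "\<And>t \<omega>. 3 \<le> t \<Longrightarrow> \<omega> \<in> space M \<Longrightarrow>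
      is_arg_max (\<lambda>i. ucb_index \<rho> X \<pi> i (t - 1) \<omega>) (\<lambda>i. i \<in> {1, 2}) (\<pi> t \<omega>)"
    and non_anticipating: "\<And>t. 1 \<le> t \<Longrightarrow>
      \<pi> t \<in> past M S U X \<pi> t \<rightarrow>\<^sub>M count_space UNIV"

text \<open>
  Convergence in probability to a constant, for random variables that live on different
  probability spaces. Measurability is part of the notion because \<open>measure\<close> is 0 on
  non-measurable sets.
\<close>

definition converges_in_prob ::
  "(nat \<Rightarrow> 'a measure) \<Rightarrow> (nat \<Rightarrow> 'a \<Rightarrow> real) \<Rightarrow> real \<Rightarrow> bool" where
  "converges_in_prob M Z c \<longleftrightarrow>
     (\<forall>n. Z n \<in> borel_measurable (M n)) \<and>
     (\<forall>\<epsilon>>0. (\<lambda>n. measure (M n) {\<omega> \<in> space (M n). \<bar>Z n \<omega> - c\<bar> > \<epsilon>}) \<longlonglongrightarrow> 0)"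

definition lambda_eq :: "real \<Rightarrow> real \<Rightarrow> real \<Rightarrow> bool" where
  "lambda_eq \<rho> \<theta> l \<longleftrightarrow> 1 / sqrt (1 - l) - 1 / sqrt l = sqrt (\<theta> / \<rho>)"

definition lambda_star :: "real \<Rightarrow> real \<Rightarrow> real" where
  "lambda_star \<rho> \<theta> = (THE l. l \<in> {0<..<1} \<and> lambda_eq \<rho> \<theta> l)"

end

theory Submission
  imports Defs "HOL-Real_Asymp.Real_Asymp"
begin

text \<open>
  By a maximal form of Hoeffding's inequality and a union bound over the dyadic blocks of sample
  sizes, for every \<open>\<epsilon> > 0\<close> there is, with probability tending to 1, no sample size \<open>m \<le> n\<close> at
  which the average of the first \<open>m\<close> rewards of an arm is off its mean by \<open>\<epsilon> * sqrt (ln n / m)\<close>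
  or more. On this event, suppose that arm \<open>i\<close> is pulled more than \<open>a * n\<close> times. At its last pull
  its index is at least that of the other arm \<open>j\<close>; arm \<open>j\<close> has been pulled at most \<open>(1 - a) * n\<close>
  times, and the current time is at least \<open>a * n - 1\<close>, so that its logarithm is asymptotic to
  \<open>ln n\<close>. After multiplication by \<open>sqrt (n / ln n)\<close> and up to vanishing errors, this reads
  \<open>sqrt \<rho> / sqrt (1 - a) \<le> (\<mu>\<^sub>i - \<mu>\<^sub>j) * sqrt (n / ln n) + sqrt \<rho> / sqrt a\<close>. Applying
  this to the optimal and to the suboptimal arm excludes, in each regime, every limit of the
  fraction except the claimed one.
\<close>

section \<open>Maximal inequalities\<close>

text \<open>Split by the first index \<open>j\<close> at which the partial sum reaches
  \<open>2 * x\<close> (event \<open>A j\<close>). The later terms are independent of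
  \<open>A j\<close>, and their sum stays below \<open>x\<close> (event \<open>B j\<close>) with
  probability at least \<open>1 - q\<close>. On \<open>A j \<inter> B j\<close> the full sum is
  still at least \<open>x\<close> in absolute value. As the \<open>A j\<close> are disjoint, summing
  over \<open>j\<close> costs nothing, and the bound on the full sum finishes the proof.\<close>

lemma (in prob_space) Ottaviani_ineq:
  fixes Y :: "nat \<Rightarrow> 'a \<Rightarrow> real"
  assumes indep: "indep_vars (\<lambda>_. borel) Y {1..K}"
    and tail: "\<And>j. j \<le> K \<Longrightarrow> prob {\<omega> \<in> space M. \<bar>\<Sum>i\<in>{j<..K}. Y i \<omega>\<bar> \<ge> x} \<le> q"
  shows "(1 - q) * prob {\<omega> \<in> space M. \<exists>m\<in>{1..K}. \<bar>\<Sum>i=1..m. Y i \<omega>\<bar> \<ge> 2 * x} \<le> q"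
proof -
  have rv [measurable]: "Y i \<in> borel_measurable M" if "i \<in> {1..K}" for i
    using indep that unfolding indep_vars_def by blast
  have sum_rv [measurable]: "(\<lambda>\<omega>. \<Sum>i\<in>I. Y i \<omega>) \<in> borel_measurable M" if "I \<subseteq> {1..K}" for I
    using that by (intro borel_measurable_sum) auto
  define A where "A = (\<lambda>j. {\<omega> \<in> space M. \<bar>\<Sum>i=1..j. Y i \<omega>\<bar> \<ge> 2 * x \<and>
    (\<forall>l\<in>{1..<j}. \<bar>\<Sum>i=1..l. Y i \<omega>\<bar> < 2 * x)})"
  define B where "B = (\<lambda>j. {\<omega> \<in> space M. \<bar>\<Sum>i\<in>{j<..K}. Y i \<omega>\<bar> < x})"
  have A_meas [measurable]: "A j \<in> events" if "j \<in> {1..K}" for j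
  proof -
    have [measurable]: "(\<lambda>\<omega>. \<Sum>i=1..l. Y i \<omega>) \<in> borel_measurable M" if "l \<le> j" for l
      using that \<open>j \<in> {1..K}\<close> by (intro sum_rv) auto
    show ?thesis unfolding A_def by measurable
  qed
  have B_meas [measurable]: "B j \<in> events" for j
  proof -
    have [measurable]: "(\<lambda>\<omega>. \<Sum>i\<in>{j<..K}. Y i \<omega>) \<in> borel_measurable M"
      by (intro sum_rv) auto
    show ?thesis unfolding B_def by measurable
  qed
  have AB: "(1 - q) * prob (A j) \<le> prob (A j \<inter> B j)" if j: "j \<in> {1..K}" for j
  proof -
    \<comment> \<open>\<open>A j\<close> depends only on the terms up to \<open>j\<close> and
      \<open>B j\<close> only on those after \<open>j\<close>. Writing both as preimages of
      measurable sets under the two restricted families transfers the independence of the families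
      to the events.\<close>
    let ?Q1 = "PiM {1..j} (\<lambda>_. borel :: real measure)"
    let ?Q2 = "PiM {j<..K} (\<lambda>_. borel :: real measure)"
    have ind: "indep_var ?Q1 (\<lambda>\<omega>. \<lambda>i\<in>{1..j}. Y i \<omega>) ?Q2 (\<lambda>\<omega>. \<lambda>i\<in>{j<..K}. Y i \<omega>)"
      using j by (intro indep_var_restrict[OF indep]) auto
    define XA where "XA = {f \<in> space ?Q1. \<bar>\<Sum>i=1..j. f i\<bar> \<ge> 2 * x \<and>
      (\<forall>l\<in>{1..<j}. \<bar>\<Sum>i=1..l. f i\<bar> < 2 * x)}"
    define XB where "XB = {f \<in> space ?Q2. \<bar>\<Sum>i\<in>{j<..K}. f i\<bar> < x}"
    have [measurable]: "(\<lambda>f. \<Sum>i=1..l. f i) \<in> borel_measurable ?Q1" if "l \<le> j" for l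
      using that by (intro borel_measurable_sum) auto
    have XA: "XA \<in> sets ?Q1" unfolding XA_def by measurable
    have XB: "XB \<in> sets ?Q2" unfolding XB_def by measurable
    have eqA: "(\<lambda>\<omega>. \<lambda>i\<in>{1..j}. Y i \<omega>) -` XA \<inter> space M = A j"
    proof -
      have "(\<Sum>i=1..l. (\<lambda>i\<in>{1..j}. Y i \<omega>) i) = (\<Sum>i=1..l. Y i \<omega>)" if "l \<le> j" for l \<omega>
        using that by (intro sum.cong) auto
      then show ?thesis
        unfolding A_def XA_def by (auto simp: space_PiM simp del: restrict_apply One_nat_def)
    qed
    have eqB: "(\<lambda>\<omega>. \<lambda>i\<in>{j<..K}. Y i \<omega>) -` XB \<inter> space M = B j"
    proof -
      have "(\<Sum>i\<in>{j<..K}. (\<lambda>i\<in>{j<..K}. Y i \<omega>) i) = (\<Sum>i\<in>{j<..K}. Y i \<omega>)" for \<omega>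
        by (intro sum.cong) auto
      then show ?thesis
        unfolding B_def XB_def by (auto simp: space_PiM simp del: restrict_apply)
    qed
    have "(\<lambda>\<omega>. (\<lambda>i\<in>{1..j}. Y i \<omega>, \<lambda>i\<in>{j<..K}. Y i \<omega>)) -` (XA \<times> XB) \<inter> space M = A j \<inter> B j"
      using eqA eqB by blast
    with indep_varD[OF ind XA XB] eqA eqB
    have "prob (A j \<inter> B j) = prob (A j) * prob (B j)" by simp
    moreover have "1 - q \<le> prob (B j)"
    proof -
      have "B j = space M - {\<omega> \<in> space M. \<bar>\<Sum>i\<in>{j<..K}. Y i \<omega>\<bar> \<ge> x}"
        by (auto simp: B_def)
      moreover have "{\<omega> \<in> space M. \<bar>\<Sum>i\<in>{j<..K}. Y i \<omega>\<bar> \<ge> x} \<in> events"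
      proof -
        have [measurable]: "(\<lambda>\<omega>. \<Sum>i\<in>{j<..K}. Y i \<omega>) \<in> borel_measurable M"
          by (intro sum_rv) auto
        show ?thesis by measurable
      qed
      ultimately show ?thesis
        using tail[of j] j by (simp add: prob_compl)
    qed
    ultimately show ?thesis
      using mult_right_mono[of "1 - q" "prob (B j)" "prob (A j)"] by (simp add: mult.commute)
  qed
  have disj: "disjoint_family_on A {1..K}"
    unfolding disjoint_family_on_def
  proof (intro ballI impI)
    fix m n assume mn: "m \<in> {1..K}" "n \<in> {1..K}" "m \<noteq> n"
    have less: "A m \<inter> A n = {}" if "m < n" "m \<in> {1..K}" for m n
    proof (rule equals0I)
      fix \<omega> assume \<omega>: "\<omega> \<in> A m \<inter> A n"
      have "m \<in> {1..<n}" using that by auto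
      then have "\<bar>\<Sum>i=1..m. Y i \<omega>\<bar> < 2 * x" using \<omega> unfolding A_def by blast
      moreover have "2 * x \<le> \<bar>\<Sum>i=1..m. Y i \<omega>\<bar>" using \<omega> unfolding A_def by blast
      ultimately show False by linarith
    qed
    show "A m \<inter> A n = {}"
      using mn less[of m n] less[of n m] by (cases m n rule: linorder_cases) auto
  qed
  have union: "{\<omega> \<in> space M. \<exists>m\<in>{1..K}. \<bar>\<Sum>i=1..m. Y i \<omega>\<bar> \<ge> 2 * x} = (\<Union>j\<in>{1..K}. A j)"
    (is "?E = _")
  proof (intro equalityI subsetI)
    fix \<omega> assume \<omega>: "\<omega> \<in> ?E"
    define P where "P = (\<lambda>m. m \<in> {1..K} \<and> \<bar>\<Sum>i=1..m. Y i \<omega>\<bar> \<ge> 2 * x)"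
    have ex: "\<exists>m. P m" using \<omega> by (auto simp: P_def)
    define m where "m = (LEAST m. P m)"
    have "P m" unfolding m_def using ex by (rule LeastI_ex)
    moreover have "\<not> P l" if "l < m" for l
      using that not_less_Least unfolding m_def by blast
    ultimately have "\<omega> \<in> A m"
      using \<omega> by (fastforce simp: A_def P_def not_le)
    then show "\<omega> \<in> (\<Union>j\<in>{1..K}. A j)" using \<open>P m\<close> by (auto simp: P_def)
  next
    fix \<omega> assume "\<omega> \<in> (\<Union>j\<in>{1..K}. A j)"
    then show "\<omega> \<in> ?E" by (auto simp: A_def)
  qed
  have "(1 - q) * prob ?E = (\<Sum>j\<in>{1..K}. (1 - q) * prob (A j))"
    unfolding union sum_distrib_left[symmetric]
    using disj by (subst finite_measure_finite_Union) auto
  also have "\<dots> \<le> (\<Sum>j\<in>{1..K}. prob (A j \<inter> B j))"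
    by (intro sum_mono AB)
  also have "\<dots> = prob (\<Union>j\<in>{1..K}. A j \<inter> B j)"
    using disj by (subst finite_measure_finite_Union) (auto simp: disjoint_family_on_def)
  \<comment> \<open>The full sum is written over \<open>{0<..K}\<close> so that it is the case
    \<open>j = 0\<close> of the hypothesis on tails.\<close>
  also have "\<dots> \<le> prob {\<omega> \<in> space M. \<bar>\<Sum>i\<in>{0<..K}. Y i \<omega>\<bar> \<ge> x}"
  proof (rule finite_measure_mono)
    show "(\<Union>j\<in>{1..K}. A j \<inter> B j) \<subseteq> {\<omega> \<in> space M. \<bar>\<Sum>i\<in>{0<..K}. Y i \<omega>\<bar> \<ge> x}"
    proof
      fix \<omega> assume "\<omega> \<in> (\<Union>j\<in>{1..K}. A j \<inter> B j)"
      then obtain j where j: "j \<in> {1..K}" "\<omega> \<in> A j" "\<omega> \<in> B j" by blast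
      have "{0<..K} = {1..j} \<union> {j<..K}" using j by auto
      then have "(\<Sum>i\<in>{0<..K}. Y i \<omega>) = (\<Sum>i=1..j. Y i \<omega>) + (\<Sum>i\<in>{j<..K}. Y i \<omega>)"
        by (simp only:) (rule sum.union_disjoint, auto)
      then show "\<omega> \<in> {\<omega> \<in> space M. \<bar>\<Sum>i\<in>{0<..K}. Y i \<omega>\<bar> \<ge> x}"
        using j by (auto simp: A_def B_def)
    qed
    have [measurable]: "(\<lambda>\<omega>. \<Sum>i\<in>{0<..K}. Y i \<omega>) \<in> borel_measurable M"
      by (intro sum_rv) auto
    show "{\<omega> \<in> space M. \<bar>\<Sum>i\<in>{0<..K}. Y i \<omega>\<bar> \<ge> x} \<in> events" by measurable
  qed
  also have "\<dots> \<le> q" using tail[of 0] by simp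
  finally show ?thesis .
qed

text \<open>Hoeffding's inequality bounds every tail sum by the same \<open>q\<close>, since fewer
  terms only improve the exponent. If \<open>q \<le> 1/2\<close>, the factor \<open>1 - q\<close> of
  Ottaviani's inequality costs at most 2, giving \<open>2 * q\<close>; otherwise
  \<open>2 * q\<close> exceeds 1 and the bound is trivial.\<close>

lemma (in prob_space) Hoeffding_maximal_ineq:
  fixes Y :: "nat \<Rightarrow> 'a \<Rightarrow> real"
  assumes indep: "indep_vars (\<lambda>_. borel) Y {1..K}"
    and bounded: "\<And>i. i \<in> {1..K} \<Longrightarrow> AE \<omega> in M. Y i \<omega> \<in> {0..1}"
    and mean: "\<And>i. i \<in> {1..K} \<Longrightarrow> expectation (Y i) = \<mu>"
    and x: "x > 0"
  shows "prob {\<omega> \<in> space M. \<exists>m\<in>{1..K}. \<bar>(\<Sum>i=1..m. Y i \<omega>) - real m * \<mu>\<bar> \<ge> 2 * x}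
    \<le> 4 * exp (- 2 * x\<^sup>2 / real K)"
    (is "?p \<le> _")
proof (cases "K = 0")
  case True
  then show ?thesis by simp
next
  case False
  define q where "q = 2 * exp (- 2 * x\<^sup>2 / real K)"
  have tail: "prob {\<omega> \<in> space M. \<bar>\<Sum>i\<in>{j<..K}. Y i \<omega> - \<mu>\<bar> \<ge> x} \<le> q" if "j \<le> K" for j
  \<comment> \<open>For \<open>j = K\<close> the sum is empty and the denominator
    \<open>K - j\<close> of Hoeffding's bound vanishes; the event itself is empty because
    \<open>x > 0\<close>.\<close>
  proof (cases "j = K")
    case True
    then show ?thesis using x by (simp add: q_def)
  next
    case False
    interpret H: Hoeffding_ineq M "{j<..K}" Y "\<lambda>_. 0" "\<lambda>_. 1" "\<Sum>i\<in>{j<..K}. expectation (Y i)"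
      using bounded by unfold_locales (auto intro: indep_vars_subset[OF indep])
    have "(\<Sum>i\<in>{j<..K}. expectation (Y i)) = (\<Sum>i\<in>{j<..K}. \<mu>)"
      using mean by (intro sum.cong) auto
    then have "prob {\<omega> \<in> space M. \<bar>\<Sum>i\<in>{j<..K}. Y i \<omega> - \<mu>\<bar> \<ge> x}
      \<le> 2 * exp (- 2 * x\<^sup>2 / real (K - j))"
      using H.Hoeffding_ineq_abs_ge[of x] x that False by (simp add: sum_subtractf)
    also have "\<dots> \<le> q"
      unfolding q_def using that False x
      by (auto intro!: divide_left_mono simp: of_nat_diff)
    finally show ?thesis .
  qed
  have "indep_vars (\<lambda>_. borel) (\<lambda>i \<omega>. Y i \<omega> - \<mu>) {1..K}"
    by (rule indep_vars_compose2[OF indep]) auto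
  from Ottaviani_ineq[OF this tail]
  have main: "(1 - q) * ?p \<le> q" by (simp add: sum_subtractf)
  show ?thesis
  proof (cases "q \<le> 1/2")
    case True
    then have "1/2 * ?p \<le> (1 - q) * ?p" by (intro mult_right_mono) auto
    then show ?thesis using main by (simp add: q_def)
  next
    case False
    have "?p \<le> 1" by (rule prob_le_1)
    also have "1 \<le> 2 * q" using False by simp
    finally show ?thesis by (simp add: q_def)
  qed
qed

section \<open>The limiting fraction\<close>

lemma lambda_fun_strict_mono:
  fixes a b :: real
  assumes "0 < a" "a < b" "b < 1"
  shows "1 / sqrt (1 - a) - 1 / sqrt a < 1 / sqrt (1 - b) - 1 / sqrt b"
proof -
  have "1 / sqrt (1 - a) < 1 / sqrt (1 - b)"
    using assms by (intro divide_strict_left_mono) auto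
  moreover have "1 / sqrt b < 1 / sqrt a"
    using assms by (intro divide_strict_left_mono) auto
  ultimately show ?thesis by linarith
qed

lemma lambda_fun_less_iff:
  fixes a b :: real
  assumes "a \<in> {0<..<1}" "b \<in> {0<..<1}"
  shows "1 / sqrt (1 - a) - 1 / sqrt a < 1 / sqrt (1 - b) - 1 / sqrt b \<longleftrightarrow> a < b"
  using lambda_fun_strict_mono[of a b] lambda_fun_strict_mono[of b a] assms
  by (cases a b rule: linorder_cases) auto

lemma lambda_eq_ex1:
  assumes "\<rho> > 0" "\<theta> \<ge> 0"
  shows "\<exists>!l. l \<in> {0<..<1} \<and> lambda_eq \<rho> \<theta> l"
proof -
  define y where "y = sqrt (\<theta> / \<rho>)"
  define g where "g = (\<lambda>l::real. 1 / sqrt (1 - l) - 1 / sqrt l)"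
  have y: "y \<ge> 0" using assms by (simp add: y_def)
  \<comment> \<open>The right end for the intermediate value theorem: \<open>b\<close> makes
    \<open>1 / sqrt (1 - b)\<close> equal to \<open>y + 2\<close>, and the subtracted
    \<open>1 / sqrt b\<close> is at most 2, so \<open>g b \<ge> y\<close>. The left end is
    \<open>1/2\<close>, where \<open>g\<close> vanishes.\<close>
  define b where "b = 1 - 1 / (y + 2)\<^sup>2"
  have "(y + 2)\<^sup>2 \<ge> 2\<^sup>2" using y by (intro power_mono) auto
  then have "1 / (y + 2)\<^sup>2 \<le> 1 / 4" by (intro divide_left_mono) auto
  moreover have "1 / (y + 2)\<^sup>2 > 0" using y by simp
  ultimately have b: "3/4 \<le> b" "b < 1" unfolding b_def by linarith+
  have "sqrt (1 - b) = 1 / (y + 2)" using y by (simp add: b_def real_sqrt_divide)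
  moreover have "1 / sqrt b \<le> 2"
  proof -
    have "sqrt (1/4) \<le> sqrt b" using b by (intro real_sqrt_le_mono) auto
    then have "1/2 \<le> sqrt b" by (simp add: real_sqrt_divide)
    then have "1 / sqrt b \<le> 1 / (1/2)" using b by (intro divide_left_mono) auto
    then show ?thesis by simp
  qed
  ultimately have "y \<le> g b" using y by (simp add: g_def)
  moreover have "g (1/2) \<le> y" using y by (simp add: g_def)
  moreover have "continuous_on {1/2..b} g"
    unfolding g_def using b by (auto intro!: continuous_intros)
  ultimately obtain l where "1/2 \<le> l" "l \<le> b" "g l = y"
    using IVT'[of g "1/2" y b] b by auto
  then have l: "l \<in> {0<..<1}" "lambda_eq \<rho> \<theta> l"
    using b by (auto simp: lambda_eq_def g_def y_def)
  show ?thesis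
  proof (intro ex1I[of _ l])
    fix l' assume "l' \<in> {0<..<1} \<and> lambda_eq \<rho> \<theta> l'"
    with l show "l' = l"
      using lambda_fun_less_iff[of l l'] lambda_fun_less_iff[of l' l]
      by (cases l l' rule: linorder_cases) (auto simp: lambda_eq_def)
  qed (use l in auto)
qed

lemma lambda_star_props:
  assumes "\<rho> > 0" "\<theta> \<ge> 0"
  shows "0 < lambda_star \<rho> \<theta>" "lambda_star \<rho> \<theta> < 1"
    and "1 / sqrt (1 - lambda_star \<rho> \<theta>) - 1 / sqrt (lambda_star \<rho> \<theta>) = sqrt (\<theta> / \<rho>)"
  using theI'[OF lambda_eq_ex1[OF assms]]
  unfolding lambda_star_def[symmetric] by (auto simp: lambda_eq_def)

text \<open>The defining function of the root is strictly increasing, so comparing with the root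
  amounts to comparing function values. This and its mirror image below give monotonicity, the value
  at 0 and the limit at infinity, and they supply the strict inequalities for the moderate
  gap.\<close>

lemma less_lambda_star_iff:
  assumes "\<rho> > 0" "\<theta> \<ge> 0" "0 < a" "a < 1"
  shows "a < lambda_star \<rho> \<theta> \<longleftrightarrow> 1 / sqrt (1 - a) - 1 / sqrt a < sqrt (\<theta> / \<rho>)"
  using lambda_fun_less_iff[of a "lambda_star \<rho> \<theta>"] lambda_star_props[of \<rho> \<theta>] assms by auto

lemma lambda_star_less_iff:
  assumes "\<rho> > 0" "\<theta> \<ge> 0" "0 < a" "a < 1"
  shows "lambda_star \<rho> \<theta> < a \<longleftrightarrow> sqrt (\<theta> / \<rho>) < 1 / sqrt (1 - a) - 1 / sqrt a"
  using lambda_fun_less_iff[of "lambda_star \<rho> \<theta>" a] lambda_star_props[of \<rho> \<theta>] assms by auto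

lemma strict_mono_on_lambda_star:
  assumes "\<rho> > 0"
  shows "strict_mono_on {0..} (lambda_star \<rho>)"
proof (intro strict_mono_onI)
  fix r s :: real assume rs: "r \<in> {0..}" "s \<in> {0..}" "r < s"
  then show "lambda_star \<rho> r < lambda_star \<rho> s"
    using less_lambda_star_iff[of \<rho> s "lambda_star \<rho> r"] lambda_star_props[of \<rho> r] assms
    by (simp add: divide_strict_right_mono)
qed

lemma lambda_star_0:
  assumes "\<rho> > 0"
  shows "lambda_star \<rho> 0 = 1 / 2"
  using less_lambda_star_iff[of \<rho> 0 "1/2"] lambda_star_less_iff[of \<rho> 0 "1/2"] assms
  by auto

lemma tendsto_lambda_star_at_top:
  assumes "\<rho> > 0"
  shows "(lambda_star \<rho> \<longlongrightarrow> 1) at_top"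
proof (rule order_tendstoI)
  fix a :: real assume "a < 1"
  \<comment> \<open>The maximum with \<open>1/2\<close> moves the level into (0, 1), where the
    comparison lemma applies, even if \<open>a\<close> is not positive. Its function value
    \<open>c\<close> is exceeded by \<open>sqrt (\<theta> / \<rho>)\<close> once
    \<open>\<theta> > \<rho> * c\<^sup>2\<close>.\<close>
  define b where "b = max a (1/2)"
  have b: "0 < b" "b < 1" "a \<le> b" using \<open>a < 1\<close> by (auto simp: b_def)
  define c where "c = 1 / sqrt (1 - b) - 1 / sqrt b"
  have "eventually (\<lambda>\<theta>. \<theta> > max 0 (\<rho> * c\<^sup>2)) at_top" by (rule eventually_gt_at_top)
  then show "eventually (\<lambda>\<theta>. a < lambda_star \<rho> \<theta>) at_top"
  proof eventually_elim
    case (elim \<theta>)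
    have "\<theta> > 0" using elim by (rule le_less_trans[OF max.cobounded1])
    have "c\<^sup>2 < \<theta> / \<rho>" using assms elim by (simp add: field_simps)
    then have "c < sqrt (\<theta> / \<rho>)" by (rule real_less_rsqrt)
    then have "b < lambda_star \<rho> \<theta>"
      using less_lambda_star_iff[of \<rho> \<theta> b] assms b \<open>\<theta> > 0\<close> by (auto simp: c_def)
    then show ?case using b by simp
  qed
next
  fix a :: real assume "1 < a"
  show "eventually (\<lambda>\<theta>. lambda_star \<rho> \<theta> < a) at_top"
    using eventually_ge_at_top[of 0]
  proof eventually_elim
    case (elim \<theta>)
    then show ?case using lambda_star_props(2)[of \<rho> \<theta>] assms \<open>1 < a\<close> by simp
  qed
qed

section \<open>Uniform deviation of the empirical means\<close>

context two_armed_bandit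
begin

lemma rewards_measurable: "X i j \<in> borel_measurable M" if "i \<in> {1, 2}" "1 \<le> j"
  using indep that unfolding indep_vars_def by force

text \<open>The assumed independence is indexed by pairs. The singleton blocks
  \<open>{(i, j)}\<close> are disjoint for distinct \<open>j\<close>, which reindexes the family by
  \<open>j\<close>; evaluation at \<open>(i, j)\<close> then recovers the rewards.\<close>

lemma indep_rewards: "indep_vars (\<lambda>_. borel) (X i) {1..K}" if "i \<in> {1, 2}"
proof -
  have "indep_vars (\<lambda>j. PiM {(i, j)} (\<lambda>_. borel))
      (\<lambda>j \<omega>. restrict (\<lambda>k. (case k of (i, j) \<Rightarrow> X i j) \<omega>) {(i, j)}) {1..K}"
    using that by (intro indep_vars_restrict[OF indep]) (auto simp: disjoint_family_on_def)
  from indep_vars_compose2[OF this, where Y = "\<lambda>j f. f (i, j)" and N = "\<lambda>_. borel"]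
  show ?thesis by simp
qed

lemma AE_rewards: "AE \<omega> in M. X i j \<omega> \<in> {0..1}" if "i \<in> {1, 2}" "1 \<le> j"
proof -
  have "AE x in distr M borel (X i j). x \<in> {0..1}"
    unfolding law[OF that] by (rule supported[OF that(1)])
  then show ?thesis by (subst (asm) AE_distr_iff[OF rewards_measurable[OF that]]) auto
qed

lemma expectation_rewards: "expectation (X i j) = arm_mean P i" if "i \<in> {1, 2}" "1 \<le> j"
  using integral_distr[OF rewards_measurable[OF that], of "\<lambda>x. x"]
  by (simp add: law[OF that] arm_mean_def)

text \<open>The event refers to deterministic sample sizes and not to the policy, so outside it any
  random pull count up to \<open>n\<close> may be inserted for \<open>m\<close>. With
  \<open>c = \<epsilon>\<^sup>2 * ln n\<close>, division by \<open>m\<close> turns the threshold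
  into \<open>\<epsilon> * sqrt (ln n / m)\<close>, the scale of the exploration bonus.\<close>

definition large_deviation :: "real \<Rightarrow> nat \<Rightarrow> 'a set" where
  "large_deviation c n = {\<omega> \<in> space M. \<exists>i\<in>{1, 2}. \<exists>m\<in>{1..n}.
     \<bar>(\<Sum>j=1..m. X i j \<omega>) - real m * arm_mean P i\<bar> \<ge> sqrt (c * real m)}"

lemma reward_sums_measurable:
  "(\<lambda>\<omega>. \<Sum>j=1..m. X i j \<omega>) \<in> borel_measurable M" if "i \<in> {1, 2}"
  using that by (intro borel_measurable_sum rewards_measurable) auto

lemma large_deviation_measurable: "large_deviation c n \<in> events"
proof -
  have [measurable]: "(\<lambda>\<omega>. \<Sum>j=1..m. X i j \<omega>) \<in> borel_measurable M" if "i \<in> {1, 2}" for i m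
    using that by (rule reward_sums_measurable)
  show ?thesis unfolding large_deviation_def by measurable
qed

text \<open>Within a dyadic block the threshold is at least its value \<open>2 * x\<close> at the
  left end \<open>2 ^ k\<close>, while the maximal inequality runs up to twice that length. The two
  powers of 2 cancel in the exponent, so the bound does not depend on \<open>k\<close>.\<close>

lemma prob_large_deviation_dyadic:
  assumes i: "i \<in> {1, 2}" and c: "c > 0"
  shows "prob {\<omega> \<in> space M. \<exists>m\<in>{2^k..<2^Suc k}.
      \<bar>(\<Sum>j=1..m. X i j \<omega>) - real m * arm_mean P i\<bar> \<ge> sqrt (c * real m)} \<le> 4 * exp (- c / 4)"
proof -
  note [measurable] = reward_sums_measurable[OF i]
  define x where "x = sqrt (c * 2 ^ k) / 2"
  have "prob {\<omega> \<in> space M. \<exists>m\<in>{2^k..<2^Suc k}.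
      \<bar>(\<Sum>j=1..m. X i j \<omega>) - real m * arm_mean P i\<bar> \<ge> sqrt (c * real m)}
    \<le> prob {\<omega> \<in> space M. \<exists>m\<in>{1..2^Suc k}.
      \<bar>(\<Sum>j=1..m. X i j \<omega>) - real m * arm_mean P i\<bar> \<ge> 2 * x}"
  proof (rule finite_measure_mono)
    show "{\<omega> \<in> space M. \<exists>m\<in>{2^k..<2^Suc k}.
        \<bar>(\<Sum>j=1..m. X i j \<omega>) - real m * arm_mean P i\<bar> \<ge> sqrt (c * real m)}
      \<subseteq> {\<omega> \<in> space M. \<exists>m\<in>{1..2^Suc k}.
        \<bar>(\<Sum>j=1..m. X i j \<omega>) - real m * arm_mean P i\<bar> \<ge> 2 * x}"
    proof safe
      fix \<omega> m assume m: "m \<in> {2^k..<2^Suc k}"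
        "sqrt (c * real m) \<le> \<bar>(\<Sum>j=1..m. X i j \<omega>) - real m * arm_mean P i\<bar>"
      have "real (2 ^ k) \<le> real m" using m(1) unfolding of_nat_le_iff by simp
      then have "2 * x \<le> sqrt (c * real m)" using c by (simp add: x_def)
      moreover have "(1::nat) \<le> 2 ^ k" by simp
      then have "m \<in> {1..2^Suc k}" using m(1) by (simp del: one_le_power)
      ultimately show "\<exists>m\<in>{1..2^Suc k}. 2 * x \<le> \<bar>(\<Sum>j=1..m. X i j \<omega>) - real m * arm_mean P i\<bar>"
        using m(2) by force
    qed
  qed measurable
  also have "\<dots> \<le> 4 * exp (- 2 * x\<^sup>2 / real (2 ^ Suc k))"
    using i c AE_rewards expectation_rewards
    by (intro Hoeffding_maximal_ineq indep_rewards) (auto simp: x_def)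
  also have "- 2 * x\<^sup>2 / real (2 ^ Suc k) = - c / 4"
    using c by (simp add: x_def power_divide)
  finally show ?thesis .
qed

text \<open>Union bound over the \<open>2 * J\<close> pairs of an arm and a dyadic block; the blocks
  with \<open>k < J\<close> cover all sample sizes from 1 to \<open>n\<close>.\<close>

lemma prob_large_deviation:
  assumes c: "c > 0" and n: "n < 2 ^ J"
  shows "prob (large_deviation c n) \<le> 8 * real J * exp (- c / 4)"
proof -
  define D where "D = (\<lambda>(i, k::nat). {\<omega> \<in> space M. \<exists>m\<in>{2^k..<2^Suc k}.
      \<bar>(\<Sum>j=1..m. X i j \<omega>) - real m * arm_mean P i\<bar> \<ge> sqrt (c * real m)})"
  have D: "D p \<in> events" if "p \<in> {1, 2} \<times> {..<J}" for p
  proof -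
    obtain i k where p: "p = (i, k)" "i \<in> {1, 2}" using \<open>p \<in> _\<close> by auto
    note [measurable] = reward_sums_measurable[OF p(2)]
    show ?thesis unfolding D_def p prod.case by measurable
  qed
  have "large_deviation c n \<subseteq> (\<Union>p\<in>{1, 2} \<times> {..<J}. D p)"
  proof
    fix \<omega> assume "\<omega> \<in> large_deviation c n"
    then obtain i m where im: "\<omega> \<in> space M" "i \<in> {1, 2}" "m \<in> {1..n}"
      "\<bar>(\<Sum>j=1..m. X i j \<omega>) - real m * arm_mean P i\<bar> \<ge> sqrt (c * real m)"
      unfolding large_deviation_def by blast
    obtain k where k: "2 ^ k \<le> m" "m < 2 ^ Suc k"
      using ex_power_ivl1[of 2 m] im(3) by auto
    have "(2::nat) ^ k < 2 ^ J" using k(1) im(3) n by (meson atLeastAtMost_iff le_less_trans)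
    then have "k < J" by simp
    then have "(i, k) \<in> {1, 2} \<times> {..<J}" using im(2) by auto
    moreover have "\<omega> \<in> D (i, k)" using im k by (auto simp: D_def)
    ultimately show "\<omega> \<in> (\<Union>p\<in>{1, 2} \<times> {..<J}. D p)" by blast
  qed
  then have "prob (large_deviation c n) \<le> prob (\<Union>p\<in>{1, 2} \<times> {..<J}. D p)"
    using D by (intro finite_measure_mono) auto
  also have "\<dots> \<le> (\<Sum>p\<in>{1, 2} \<times> {..<J}. prob (D p))"
    using D by (intro finite_measure_subadditive_finite) auto
  also have "\<dots> \<le> (\<Sum>p\<in>{1, 2::nat} \<times> {..<J}. 4 * exp (- c / 4))"
  proof (rule sum_mono)
    fix p assume "p \<in> {1, 2::nat} \<times> {..<J}"
    then obtain i k where "p = (i, k)" "i \<in> {1, 2}" by auto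
    then show "prob (D p) \<le> 4 * exp (- c / 4)"
      using prob_large_deviation_dyadic[of i c k] c by (simp only: D_def prod.case)
  qed
  also have "\<dots> = 8 * real J * exp (- c / 4)"
    by (simp add: card_cartesian_product)
  finally show ?thesis .
qed

end

text \<open>There are only logarithmically many blocks, each contributing a multiple of
  \<open>n powr (- \<epsilon> / 4)\<close>, so every \<epsilon> > 0 is admissible. A union bound
  over all \<open>n\<close> sample sizes would cost a factor \<open>n\<close> and fail for small
  \<epsilon>.\<close>

lemma large_deviation_tendsto_0:
  assumes bandit: "\<And>n. two_armed_bandit (M n) (P n) (X n)" and \<epsilon>: "\<epsilon> > 0"
  shows "(\<lambda>n. measure (M n) (two_armed_bandit.large_deviation (M n) (P n) (X n)
    (\<epsilon> * ln (real n)) n)) \<longlonglongrightarrow> 0"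
proof (rule tendsto_sandwich[OF _ _ tendsto_const])
  show "eventually (\<lambda>n. measure (M n) (two_armed_bandit.large_deviation (M n) (P n) (X n)
      (\<epsilon> * ln (real n)) n) \<le> 8 * (log 2 (real n) + 1) * exp (- (\<epsilon> * ln (real n)) / 4)) sequentially"
    using eventually_ge_at_top[of 2]
  proof eventually_elim
    case (elim n)
    interpret two_armed_bandit "M n" "P n" "X n" by (rule bandit)
    \<comment> \<open>The number of binary digits of \<open>n\<close>, hence the least
      \<open>J\<close> with \<open>n < 2 ^ J\<close>.\<close>
    define J where "J = nat \<lfloor>log 2 (real n)\<rfloor> + 1"
    have "log 2 (real n) < real J" unfolding J_def by linarith
    then have "real n < 2 powr real J" using elim by (simp add: log_less_iff)
    then have "real n < real (2 ^ J)" by (simp add: powr_realpow)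
    then have "n < 2 ^ J" unfolding of_nat_less_iff .
    then have "prob (large_deviation (\<epsilon> * ln (real n)) n)
      \<le> 8 * real J * exp (- (\<epsilon> * ln (real n)) / 4)"
      using elim \<epsilon> by (intro prob_large_deviation) auto
    also have "real J \<le> log 2 (real n) + 1"
      using elim by (simp add: J_def)
    finally show ?case by simp
  qed
  show "(\<lambda>n. 8 * (log 2 (real n) + 1) * exp (- (\<epsilon> * ln (real n)) / 4)) \<longlonglongrightarrow> 0"
    using \<epsilon> by real_asymp
qed (auto simp: measure_nonneg)

section \<open>Pull counts\<close>

lemma pulls_0 [simp]: "pulls \<pi> i 0 \<omega> = 0"
  by (simp add: pulls_def)

lemma pulls_Suc: "pulls \<pi> i (Suc t) \<omega> = pulls \<pi> i t \<omega> + (if \<pi> (Suc t) \<omega> = i then 1 else 0)"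
proof -
  have "{s \<in> {1..Suc t}. \<pi> s \<omega> = i} =
      (if \<pi> (Suc t) \<omega> = i then insert (Suc t) {s \<in> {1..t}. \<pi> s \<omega> = i} else {s \<in> {1..t}. \<pi> s \<omega> = i})"
    by (auto simp: le_Suc_eq)
  then show ?thesis by (simp add: pulls_def)
qed

lemma pulls_mono: "s \<le> t \<Longrightarrow> pulls \<pi> i s \<omega> \<le> pulls \<pi> i t \<omega>"
  unfolding pulls_def by (intro card_mono) auto

lemma pulls_le: "pulls \<pi> i t \<omega> \<le> t"
  by (induction t) (auto simp: pulls_Suc)

lemma pulls_add_pulls:
  assumes "\<And>s. 1 \<le> s \<Longrightarrow> \<pi> s \<omega> \<in> {i, j}" and "i \<noteq> j"
  shows "pulls \<pi> i t \<omega> + pulls \<pi> j t \<omega> = t"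
proof (induction t)
  case (Suc t)
  then show ?case using assms(1)[of "Suc t"] assms(2) by (auto simp: pulls_Suc)
qed simp

text \<open>Writing the time of the last pull as \<open>Suc t\<close> makes \<open>t\<close> the
  time whose indices decide that pull. The count at \<open>t\<close> misses only this one pull, so a
  lower bound on the final count carries over to \<open>t\<close> up to 1.\<close>

lemma last_pull:
  assumes "pulls \<pi> i n \<omega> > 0"
  obtains t where "t < n" "\<pi> (Suc t) \<omega> = i" "pulls \<pi> i n \<omega> = Suc (pulls \<pi> i t \<omega>)"
proof -
  have "\<exists>t<n. \<pi> (Suc t) \<omega> = i \<and> pulls \<pi> i n \<omega> = Suc (pulls \<pi> i t \<omega>)"
    using assms
  proof (induction n)
    case (Suc n)
    then show ?case by (cases "\<pi> (Suc n) \<omega> = i") (auto simp: pulls_Suc less_Suc_eq)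
  qed simp
  then show ?thesis using that by blast
qed

section \<open>Pull counts under the UCB policy: measurability and the inequality at the last
  pull\<close>

context canonical_ucb
begin

lemma arms_pulls_add: "\<omega> \<in> space M \<Longrightarrow> pulls \<pi> 1 t \<omega> + pulls \<pi> 2 t \<omega> = t"
  using arm by (intro pulls_add_pulls) auto

lemma pulls_ge_1:
  assumes "\<omega> \<in> space M" "i \<in> {1, 2}" "2 \<le> t"
  shows "1 \<le> pulls \<pi> i t \<omega>"
proof -
  have "1 \<le> pulls \<pi> i (Suc (Suc 0)) \<omega>"
    using initial[OF assms(1)] arm[of 1, OF _ assms(1)] arm[of 2, OF _ assms(1)] assms(2)
    by (auto simp: pulls_Suc numeral_2_eq_2)
  also have "\<dots> \<le> pulls \<pi> i t \<omega>" using assms(3) by (intro pulls_mono) simp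
  finally show ?thesis .
qed

text \<open>Strong induction on time. The past at \<open>t\<close> is generated by the randomization
  and by the plays and rewards at times before \<open>t\<close>, all measurable by the induction
  hypothesis; hence it is contained in the sigma-algebra of \<open>M\<close>, and a decision
  measurable with respect to it is a random variable on \<open>M\<close>.\<close>

lemma pi_measurable:
  "1 \<le> t \<Longrightarrow> \<pi> t \<in> M \<rightarrow>\<^sub>M count_space UNIV"
proof (induction t rule: less_induct)
  case (less t)
  \<comment> \<open>Inserting random indices needs measurability for all \<open>i\<close> and
    \<open>j\<close>, but rewards are known to be measurable only for actual arms and
    \<open>j \<ge> 1\<close>. The values 0 elsewhere are never observed, since the arm played at
    \<open>s\<close> has at least one pull by then.\<close>
  define X' where "X' = (\<lambda>i j. if i \<in> {1, 2} \<and> 1 \<le> j then X i j else (\<lambda>_. 0))"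
  have X' [measurable]: "X' i j \<in> borel_measurable M" for i j
    unfolding X'_def using rewards_measurable by auto
  have pi [measurable]: "\<pi> s \<in> M \<rightarrow>\<^sub>M count_space UNIV" if "s \<in> {1..<t}" for s
    using less.IH that by auto
  have rew: "observed_reward X \<pi> s \<in> borel_measurable M" if s: "s \<in> {1..<t}" for s
  proof -
    have [measurable]: "pulls \<pi> i s \<in> M \<rightarrow>\<^sub>M count_space UNIV" for i
    proof -
      have "pulls \<pi> i r \<in> M \<rightarrow>\<^sub>M count_space UNIV" if "r < t" for r
        using that
      proof (induction r)
        case 0
        then show ?case by (simp add: pulls_def)
      next
        case (Suc r)
        have [measurable]: "pulls \<pi> i r \<in> M \<rightarrow>\<^sub>M count_space UNIV"
          "\<pi> (Suc r) \<in> M \<rightarrow>\<^sub>M count_space UNIV"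
          using Suc pi[of "Suc r"] by auto
        show ?case by (subst pulls_Suc[abs_def]) measurable
      qed
      then show ?thesis using s by simp
    qed
    have [measurable]: "\<pi> s \<in> M \<rightarrow>\<^sub>M count_space UNIV" using s by (rule pi)
    have "(\<lambda>\<omega>. X' (\<pi> s \<omega>) (pulls \<pi> (\<pi> s \<omega>) s \<omega>) \<omega>) \<in> borel_measurable M"
      by measurable
    moreover have "X' (\<pi> s \<omega>) (pulls \<pi> (\<pi> s \<omega>) s \<omega>) \<omega> = observed_reward X \<pi> s \<omega>"
      if "\<omega> \<in> space M" for \<omega>
    proof -
      obtain r where "s = Suc r" using s by (cases s) auto
      then have "1 \<le> pulls \<pi> (\<pi> s \<omega>) s \<omega>" by (simp add: pulls_Suc)
      then show ?thesis
        using arm[of s \<omega>] s that by (auto simp: X'_def observed_reward_def)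
    qed
    ultimately show ?thesis by (simp cong: measurable_cong)
  qed
  let ?N = "S \<Otimes>\<^sub>M PiM {1..<t} (\<lambda>_. count_space UNIV \<Otimes>\<^sub>M borel)"
  let ?h = "\<lambda>\<omega>. (U \<omega>, \<lambda>s\<in>{1..<t}. (\<pi> s \<omega>, observed_reward X \<pi> s \<omega>))"
  have h: "?h \<in> M \<rightarrow>\<^sub>M ?N"
    using randomization pi rew by (intro measurable_Pair measurable_restrict) auto
  have "sets (past M S U X \<pi> t) \<subseteq> sets M"
    unfolding past_def using h
    by (subst sets_vimage_algebra2) (auto dest: measurable_space intro: measurable_sets)
  then show ?case
    using non_anticipating[OF less.prems]
    by (auto simp: measurable_def past_def)
qed

lemma pulls_measurable: "pulls \<pi> i t \<in> M \<rightarrow>\<^sub>M count_space UNIV"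
proof (induction t)
  case 0
  then show ?case by (simp add: pulls_def)
next
  case (Suc t)
  note [measurable] = Suc pi_measurable[of "Suc t", simplified]
  show ?case by (subst pulls_Suc[abs_def]) measurable
qed

text \<open>The comparison at the last pull for a fixed horizon. Here \<open>k\<close> replaces
  \<open>sqrt \<rho>\<close> on the side of arm \<open>j\<close>, since the logarithm at the last
  pull may be as small as \<open>ln (a * n - 1)\<close>. The condition
  \<open>\<epsilon> \<le> k\<close> keeps the factor of \<open>sqrt (L / r)\<close> nonnegative, so
  that the upper bound on \<open>r\<close> can be inserted.\<close>

lemma pulls_bound:
  fixes a \<epsilon> :: real
  assumes \<omega>: "\<omega> \<in> space M" "\<omega> \<notin> large_deviation (\<epsilon>\<^sup>2 * ln (real n)) n"
    and ij: "i \<in> {1, 2}" "j \<in> {1, 2}" "i \<noteq> j"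
    and a: "0 < a" "a < 1" "a * real n \<ge> 3"
    and pulls: "real (pulls \<pi> i n \<omega>) > a * real n"
    and \<rho>: "\<rho> > 0" and \<epsilon>: "\<epsilon> > 0"
    and k: "k = sqrt (\<rho> * (ln (a * real n - 1) / ln (real n)))" "\<epsilon> \<le> k"
  shows "(k - \<epsilon>) / sqrt (1 - a) \<le>
    (arm_mean P i - arm_mean P j) * sqrt (real n / ln (real n)) +
    (sqrt \<rho> + \<epsilon>) * sqrt (real n / (a * real n - 1))"
proof -
  define L where "L = ln (real n)"
  have n: "real n \<ge> 3" using a mult_right_mono[of a 1 "real n"] by simp
  have L: "L > 0" using n by (simp add: L_def)
  have "real (pulls \<pi> i n \<omega>) > 0" using pulls a by linarith
  then have "pulls \<pi> i n \<omega> > 0" by simp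
  then obtain t where t: "t < n" "\<pi> (Suc t) \<omega> = i" "pulls \<pi> i n \<omega> = Suc (pulls \<pi> i t \<omega>)"
    by (rule last_pull)
  define p where "p = pulls \<pi> i t \<omega>"
  define r where "r = pulls \<pi> j t \<omega>"
  \<comment> \<open>The pull at \<open>Suc t\<close> is not counted in \<open>p\<close>, hence the
    \<open>- 1\<close>. As \<open>a * n \<ge> 3\<close>, it follows that \<open>t \<ge> 2\<close>,
    so time \<open>Suc t\<close> is governed by the UCB rule and not by the initial plays.\<close>
  have p: "real p > a * real n - 1" using pulls t(3) by (simp add: p_def)
  have "p > 1" using p a by linarith
  have "p \<le> t" unfolding p_def by (rule pulls_le)
  then have t2: "2 \<le> t" using \<open>p > 1\<close> by simp
  have r1: "1 \<le> r" unfolding r_def using \<omega>(1) ij(2) t2 by (rule pulls_ge_1)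
  have rt: "r \<le> t" unfolding r_def by (rule pulls_le)
  have "r \<le> pulls \<pi> j n \<omega>" unfolding r_def using t by (intro pulls_mono) simp
  moreover have "pulls \<pi> i n \<omega> + pulls \<pi> j n \<omega> = n"
    using arms_pulls_add[OF \<omega>(1), of n] ij by auto
  ultimately have "real r + real (pulls \<pi> i n \<omega>) \<le> real n" by linarith
  then have r: "real r \<le> (1 - a) * real n" using pulls by (simp add: algebra_simps)
  have dev: "\<bar>empirical_mean X \<pi> l t \<omega> - arm_mean P l\<bar> \<le> \<epsilon> * sqrt (L / real m)"
    if m: "m = pulls \<pi> l t \<omega>" "1 \<le> m" "m \<le> n" "l \<in> {1, 2}" for l m
  proof -
    have "\<bar>(\<Sum>j=1..m. X l j \<omega>) - real m * arm_mean P l\<bar> < sqrt (\<epsilon>\<^sup>2 * L * real m)"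
      using \<omega> m(2,3,4) unfolding large_deviation_def L_def by (force simp: not_le)
    also have "\<dots> = (\<epsilon> * sqrt (L / real m)) * real m"
      using m(2) \<epsilon> L by (simp add: real_sqrt_mult real_sqrt_divide field_simps)
    finally have "\<bar>(\<Sum>j=1..m. X l j \<omega>) - real m * arm_mean P l\<bar> / real m < \<epsilon> * sqrt (L / real m)"
      using m(2) by (simp add: pos_divide_less_eq)
    moreover have "\<bar>(\<Sum>j=1..m. X l j \<omega>) - real m * arm_mean P l\<bar> / real m =
        \<bar>empirical_mean X \<pi> l t \<omega> - arm_mean P l\<bar>"
    proof -
      have "empirical_mean X \<pi> l t \<omega> - arm_mean P l =
          ((\<Sum>j=1..m. X l j \<omega>) - real m * arm_mean P l) / real m"
        using m(2) unfolding empirical_mean_def m(1)[symmetric] by (simp add: diff_divide_distrib)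
      then show ?thesis by (simp add: abs_divide)
    qed
    ultimately show ?thesis by simp
  qed
  have "ucb_index \<rho> X \<pi> j t \<omega> \<le> ucb_index \<rho> X \<pi> i t \<omega>"
    using ucb_rule[of "Suc t" \<omega>] t t2 \<omega>(1) ij by (auto simp: is_arg_max_def not_less)
  moreover have "\<bar>empirical_mean X \<pi> i t \<omega> - arm_mean P i\<bar> \<le> \<epsilon> * sqrt (L / real p)"
    using \<open>p > 1\<close> \<open>p \<le> t\<close> t(1) ij by (intro dev) (auto simp: p_def)
  moreover have "\<bar>empirical_mean X \<pi> j t \<omega> - arm_mean P j\<bar> \<le> \<epsilon> * sqrt (L / real r)"
    using r1 rt t(1) ij by (intro dev) (auto simp: r_def)
  ultimately have index: "arm_mean P j - \<epsilon> * sqrt (L / real r) + sqrt (\<rho> * ln (real t) / real r)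
      \<le> arm_mean P i + \<epsilon> * sqrt (L / real p) + sqrt (\<rho> * ln (real t) / real p)"
    unfolding ucb_index_def p_def[symmetric] r_def[symmetric] by linarith
  \<comment> \<open>The bonus of \<open>i\<close> is bounded above through \<open>t < n\<close>,
    that of \<open>j\<close> below through \<open>t \<ge> p > a * n - 1\<close>. Afterwards both
    bonuses and both deviations are multiples of \<open>sqrt (L / p)\<close> or
    \<open>sqrt (L / r)\<close>.\<close>
  have "sqrt (\<rho> * ln (real t) / real p) \<le> sqrt (\<rho> * L / real p)"
    using \<rho> t t2 unfolding L_def by (intro real_sqrt_le_mono divide_right_mono mult_left_mono) auto
  also have "\<dots> = sqrt \<rho> * sqrt (L / real p)" by (simp add: real_sqrt_mult real_sqrt_divide)
  finally have i_up: "sqrt (\<rho> * ln (real t) / real p) \<le> sqrt \<rho> * sqrt (L / real p)" .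
  have "ln (a * real n - 1) \<le> ln (real t)"
    using p \<open>p \<le> t\<close> a by (subst ln_le_cancel_iff) auto
  then have "sqrt (\<rho> * ln (a * real n - 1) / real r) \<le> sqrt (\<rho> * ln (real t) / real r)"
    using \<rho> by (intro real_sqrt_le_mono divide_right_mono mult_left_mono) auto
  moreover have "sqrt (\<rho> * ln (a * real n - 1) / real r) = k * sqrt (L / real r)"
    using L unfolding k L_def[symmetric] by (simp flip: real_sqrt_mult)
  ultimately have "(k - \<epsilon>) * sqrt (L / real r) \<le> arm_mean P i - arm_mean P j +
      (sqrt \<rho> + \<epsilon>) * sqrt (L / real p)"
    using index i_up by (simp add: algebra_simps)
  moreover have "(k - \<epsilon>) * sqrt (L / ((1 - a) * real n)) \<le> (k - \<epsilon>) * sqrt (L / real r)"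
    using k(2) r r1 L a n by (intro mult_left_mono real_sqrt_le_mono divide_left_mono mult_pos_pos) auto
  moreover have "(sqrt \<rho> + \<epsilon>) * sqrt (L / real p) \<le> (sqrt \<rho> + \<epsilon>) * sqrt (L / (a * real n - 1))"
    using p a \<rho> \<epsilon> L \<open>p > 1\<close>
    by (intro mult_left_mono real_sqrt_le_mono divide_left_mono mult_pos_pos) auto
  ultimately have "(k - \<epsilon>) * sqrt (L / ((1 - a) * real n)) \<le> arm_mean P i - arm_mean P j +
      (sqrt \<rho> + \<epsilon>) * sqrt (L / (a * real n - 1))" by linarith
  \<comment> \<open>Multiplication by \<open>sqrt (n / L)\<close> cancels \<open>L\<close> from the
    bonus terms and puts the difference of means on the scale of the theorem.\<close>
  then have "(k - \<epsilon>) * sqrt (L / ((1 - a) * real n)) * sqrt (real n / L) \<le>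
      (arm_mean P i - arm_mean P j + (sqrt \<rho> + \<epsilon>) * sqrt (L / (a * real n - 1))) * sqrt (real n / L)"
    using L by (intro mult_right_mono) auto
  moreover have "sqrt (L / ((1 - a) * real n)) * sqrt (real n / L) = 1 / sqrt (1 - a)"
    using L n a by (simp add: real_sqrt_mult real_sqrt_divide)
  moreover have "sqrt (L / (a * real n - 1)) * sqrt (real n / L) = sqrt (real n / (a * real n - 1))"
    using L n a by (simp add: real_sqrt_divide)
  ultimately show ?thesis unfolding L_def[symmetric]
    by (simp add: distrib_right mult.assoc)
qed

end

section \<open>Limits in probability\<close>

text \<open>The strict inequality on \<open>s\<close> is the negation, with room to spare, of the
  limiting form of \<open>pulls_bound\<close>. So for a small fixed \<epsilon> and all large
  \<open>n\<close>, more than \<open>a * n\<close> pulls of arm \<open>i n\<close> force a large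
  deviation. The roles of the arms are left open because the lemma is applied to the optimal and to
  the suboptimal arm; \<open>s\<close> bounds the signed, rescaled difference of means.\<close>

lemma prob_pulls_tendsto_0:
  fixes a s \<rho> :: real
  assumes \<rho>: "\<rho> > 0"
    and ucb: "\<And>n. canonical_ucb (M n) (P n) (X n) \<rho> (S n) (U n) (\<pi> n)"
    and arms: "\<And>n. i n \<in> {1, 2}" "\<And>n. j n \<in> {1, 2}" "\<And>n. i n \<noteq> j n"
    and a: "0 < a"
    and gap: "eventually (\<lambda>n. (arm_mean (P n) (i n) - arm_mean (P n) (j n)) *
      sqrt (real n / ln (real n)) \<le> s) sequentially"
    and s: "s + sqrt \<rho> / sqrt a < sqrt \<rho> / sqrt (1 - a)" and a1: "a < 1"
  shows "(\<lambda>n. measure (M n) {\<omega> \<in> space (M n). real (pulls (\<pi> n) (i n) n \<omega>) > a * real n}) \<longlonglongrightarrow> 0"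
proof -
  \<comment> \<open>By continuity at 0 the strict inequality survives a small positive \<epsilon>,
    which is fixed before \<open>n\<close> tends to infinity.\<close>
  have "((\<lambda>\<epsilon>. s + (sqrt \<rho> + \<epsilon>) / sqrt a - (sqrt \<rho> - \<epsilon>) / sqrt (1 - a)) \<longlongrightarrow>
      s + (sqrt \<rho> + 0) / sqrt a - (sqrt \<rho> - 0) / sqrt (1 - a)) (at_right 0)"
    using a a1 by (intro tendsto_intros) auto
  then have "eventually (\<lambda>\<epsilon>. s + (sqrt \<rho> + \<epsilon>) / sqrt a - (sqrt \<rho> - \<epsilon>) / sqrt (1 - a) < 0) (at_right 0)"
    using s by (intro order_tendstoD(2)) auto
  moreover have "eventually (\<lambda>\<epsilon>. \<epsilon> < sqrt \<rho>) (at_right 0)"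
    using \<rho> by (intro order_tendstoD(2)[OF tendsto_ident_at]) auto
  ultimately have "eventually (\<lambda>\<epsilon>. s + (sqrt \<rho> + \<epsilon>) / sqrt a - (sqrt \<rho> - \<epsilon>) / sqrt (1 - a) < 0
      \<and> \<epsilon> < sqrt \<rho> \<and> 0 < \<epsilon>) (at_right 0)"
    using eventually_at_right_less[of "0::real"] by eventually_elim auto
  then obtain \<epsilon> where \<epsilon>: "s + (sqrt \<rho> + \<epsilon>) / sqrt a - (sqrt \<rho> - \<epsilon>) / sqrt (1 - a) < 0"
    "\<epsilon> < sqrt \<rho>" "0 < \<epsilon>"
    using eventually_happens[of _ "at_right (0::real)"] by (auto simp: trivial_limit_at_right_real)
  define k where "k = (\<lambda>n. sqrt (\<rho> * (ln (a * real n - 1) / ln (real n))))"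
  have "(\<lambda>n. ln (a * real n - 1) / ln (real n)) \<longlonglongrightarrow> 1"
    using a by real_asymp
  then have "k \<longlonglongrightarrow> sqrt (\<rho> * 1)" unfolding k_def by (intro tendsto_intros)
  then have k: "k \<longlonglongrightarrow> sqrt \<rho>" by simp
  have "(\<lambda>n. real n / (a * real n - 1)) \<longlonglongrightarrow> inverse a"
    using a by real_asymp
  then have ratio: "(\<lambda>n. sqrt (real n / (a * real n - 1))) \<longlonglongrightarrow> sqrt (1 / a)"
    unfolding inverse_eq_divide by (rule tendsto_real_sqrt)
  have "(\<lambda>n. s + (sqrt \<rho> + \<epsilon>) * sqrt (real n / (a * real n - 1)) - (k n - \<epsilon>) / sqrt (1 - a))
      \<longlonglongrightarrow> s + (sqrt \<rho> + \<epsilon>) * sqrt (1 / a) - (sqrt \<rho> - \<epsilon>) / sqrt (1 - a)"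
    using a1 by (intro tendsto_add tendsto_diff tendsto_mult tendsto_divide tendsto_const k ratio) auto
  then have small: "eventually (\<lambda>n. s + (sqrt \<rho> + \<epsilon>) * sqrt (real n / (a * real n - 1)) -
      (k n - \<epsilon>) / sqrt (1 - a) < 0) sequentially"
    by (rule order_tendstoD(2)) (use \<epsilon>(1) in \<open>simp add: real_sqrt_divide\<close>)
  have "filterlim (\<lambda>n. a * real n) at_top sequentially"
    using a by real_asymp
  then have large: "eventually (\<lambda>n. a * real n \<ge> 3) sequentially"
    by (simp add: filterlim_at_top)
  have bandit: "two_armed_bandit (M n) (P n) (X n)" for n
    using ucb[of n] by (rule canonical_ucb.axioms(1))
  have bound: "eventually (\<lambda>n. measure (M n) {\<omega> \<in> space (M n). real (pulls (\<pi> n) (i n) n \<omega>) > a * real n} \<le>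
      measure (M n) (two_armed_bandit.large_deviation (M n) (P n) (X n) (\<epsilon>\<^sup>2 * ln (real n)) n)) sequentially"
    using gap small large order_tendstoD(1)[OF k \<epsilon>(2)]
  proof eventually_elim
    case (elim n)
    interpret canonical_ucb "M n" "P n" "X n" \<rho> "S n" "U n" "\<pi> n" by (rule ucb)
    show ?case
    proof (rule finite_measure_mono)
      show "{\<omega> \<in> space (M n). real (pulls (\<pi> n) (i n) n \<omega>) > a * real n}
        \<subseteq> large_deviation (\<epsilon>\<^sup>2 * ln (real n)) n"
      proof (rule subsetI, rule ccontr)
        fix \<omega> assume "\<omega> \<in> {\<omega> \<in> space (M n). real (pulls (\<pi> n) (i n) n \<omega>) > a * real n}"
          "\<omega> \<notin> large_deviation (\<epsilon>\<^sup>2 * ln (real n)) n"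
        then show False
          using pulls_bound[of \<omega> \<epsilon> n "i n" "j n" a "k n"] elim arms a a1 \<rho> \<epsilon>(3)
          by (auto simp: k_def)
      qed
    qed (rule large_deviation_measurable)
  qed
  show ?thesis
  proof (rule tendsto_sandwich[OF _ bound tendsto_const])
    show "(\<lambda>n. measure (M n) (two_armed_bandit.large_deviation (M n) (P n) (X n)
        (\<epsilon>\<^sup>2 * ln (real n)) n)) \<longlonglongrightarrow> 0"
      using bandit \<epsilon>(3) by (intro large_deviation_tendsto_0) auto
  qed (simp add: measure_nonneg)
qed

text \<open>The two counts sum to \<open>n\<close>, so the fraction of one arm falls below
  \<open>c - \<epsilon>\<close> exactly when that of the other exceeds
  \<open>1 - c + \<epsilon>\<close>. Upper bounds for both arms therefore suffice.\<close>

lemma pulls_frac_converges_in_prob: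
  fixes c :: real
  assumes ucb: "\<And>n. canonical_ucb (M n) (P n) (X n) \<rho> (S n) (U n) (\<pi> n)"
    and arms: "\<And>n. i n \<in> {1, 2}" "\<And>n. j n \<in> {1, 2}" "\<And>n. i n \<noteq> j n"
    and c: "0 \<le> c" "c \<le> 1"
    and upper: "\<And>a. c < a \<Longrightarrow> a < 1 \<Longrightarrow>
      (\<lambda>n. measure (M n) {\<omega> \<in> space (M n). real (pulls (\<pi> n) (i n) n \<omega>) > a * real n}) \<longlonglongrightarrow> 0"
    and lower: "\<And>a. 1 - c < a \<Longrightarrow> a < 1 \<Longrightarrow>
      (\<lambda>n. measure (M n) {\<omega> \<in> space (M n). real (pulls (\<pi> n) (j n) n \<omega>) > a * real n}) \<longlonglongrightarrow> 0"
  shows "converges_in_prob M (\<lambda>n \<omega>. real (pulls (\<pi> n) (i n) n \<omega>) / real n) c"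
  unfolding converges_in_prob_def
proof (intro conjI allI impI)
  have pulls_measurable': "(\<lambda>\<omega>. real (pulls (\<pi> n) l n \<omega>)) \<in> borel_measurable (M n)" for n l
  proof -
    interpret canonical_ucb "M n" "P n" "X n" \<rho> "S n" "U n" "\<pi> n" by (rule ucb)
    note [measurable] = pulls_measurable[of l n]
    show ?thesis by measurable
  qed
  note [measurable] = this
  show "(\<lambda>\<omega>. real (pulls (\<pi> n) (i n) n \<omega>) / real n) \<in> borel_measurable (M n)" for n
    by measurable
  \<comment> \<open>The hypotheses cover only levels below 1, but \<open>c + \<epsilon>\<close> and
    \<open>1 - c + \<epsilon>\<close> may be larger; there the event is empty because a count never
    exceeds \<open>n\<close>.\<close>
  have trivial: "(\<lambda>n. measure (M n) {\<omega> \<in> space (M n). real (pulls (\<pi> n) (l n) n \<omega>) > a * real n}) \<longlonglongrightarrow> 0"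
    if "a \<ge> 1" for a l
  proof -
    have "real (pulls (\<pi> n) (l n) n \<omega>) \<le> a * real n" for n \<omega>
      using pulls_le[of "\<pi> n" "l n" n \<omega>] mult_right_mono[OF that, of "real n"] by simp
    then show ?thesis by (simp add: not_less[symmetric] del: not_less)
  qed
  fix \<epsilon> :: real assume \<epsilon>: "\<epsilon> > 0"
  let ?E1 = "\<lambda>n. {\<omega> \<in> space (M n). real (pulls (\<pi> n) (i n) n \<omega>) > (c + \<epsilon>) * real n}"
  let ?E2 = "\<lambda>n. {\<omega> \<in> space (M n). real (pulls (\<pi> n) (j n) n \<omega>) > (1 - c + \<epsilon>) * real n}"
  have "(\<lambda>n. measure (M n) (?E1 n)) \<longlonglongrightarrow> 0"
    using upper[of "c + \<epsilon>"] trivial[of "c + \<epsilon>" i] \<epsilon> by (cases "c + \<epsilon> < 1") auto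
  moreover have "(\<lambda>n. measure (M n) (?E2 n)) \<longlonglongrightarrow> 0"
    using lower[of "1 - c + \<epsilon>"] trivial[of "1 - c + \<epsilon>" j] \<epsilon> by (cases "1 - c + \<epsilon> < 1") auto
  ultimately have lim: "(\<lambda>n. measure (M n) (?E1 n) + measure (M n) (?E2 n)) \<longlonglongrightarrow> 0"
    using tendsto_add by fastforce
  have bound: "eventually (\<lambda>n. measure (M n) {\<omega> \<in> space (M n).
      \<bar>real (pulls (\<pi> n) (i n) n \<omega>) / real n - c\<bar> > \<epsilon>} \<le> measure (M n) (?E1 n) + measure (M n) (?E2 n)) sequentially"
    using eventually_gt_at_top[of 0]
  proof eventually_elim
    case (elim n)
    interpret canonical_ucb "M n" "P n" "X n" \<rho> "S n" "U n" "\<pi> n" by (rule ucb)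
    have sub: "{\<omega> \<in> space (M n). \<bar>real (pulls (\<pi> n) (i n) n \<omega>) / real n - c\<bar> > \<epsilon>} \<subseteq> ?E1 n \<union> ?E2 n"
    proof
      fix \<omega> assume \<omega>: "\<omega> \<in> {\<omega> \<in> space (M n). \<bar>real (pulls (\<pi> n) (i n) n \<omega>) / real n - c\<bar> > \<epsilon>}"
      let ?x = "real (pulls (\<pi> n) (i n) n \<omega>)" and ?y = "real (pulls (\<pi> n) (j n) n \<omega>)"
      have "pulls (\<pi> n) (i n) n \<omega> + pulls (\<pi> n) (j n) n \<omega> = n"
        using arms_pulls_add[of \<omega> n] arms(1)[of n] arms(2)[of n] arms(3)[of n] \<omega> by auto
      then have sum: "?x + ?y = real n" by linarith
      have "?x / real n > c + \<epsilon> \<or> ?x / real n < c - \<epsilon>" using \<omega> by (auto simp: abs_if split: if_splits)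
      then have "?x > (c + \<epsilon>) * real n \<or> ?x < (c - \<epsilon>) * real n"
        using elim by (simp add: pos_less_divide_eq pos_divide_less_eq)
      then have "?x > (c + \<epsilon>) * real n \<or> ?y > (1 - c + \<epsilon>) * real n"
        using sum by (auto simp: algebra_simps)
      then show "\<omega> \<in> ?E1 n \<union> ?E2 n" using \<omega> by auto
    qed
    have "measure (M n) {\<omega> \<in> space (M n). \<bar>real (pulls (\<pi> n) (i n) n \<omega>) / real n - c\<bar> > \<epsilon>}
        \<le> measure (M n) (?E1 n \<union> ?E2 n)"
      by (rule finite_measure_mono[OF sub]) measurable
    also have "\<dots> \<le> measure (M n) (?E1 n) + measure (M n) (?E2 n)"
      by (rule measure_Un_le) measurable
    finally show ?case .
  qed
  show "(\<lambda>n. measure (M n) {\<omega> \<in> space (M n).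
      \<bar>real (pulls (\<pi> n) (i n) n \<omega>) / real n - c\<bar> > \<epsilon>}) \<longlonglongrightarrow> 0"
    by (rule tendsto_sandwich[OF _ bound tendsto_const lim]) (auto simp: measure_nonneg)
qed

theorem theorem1:
  fixes \<rho> :: real
    and M :: "nat \<Rightarrow> 'a measure"
    and P :: "nat \<Rightarrow> nat \<Rightarrow> real measure"
    and X :: "nat \<Rightarrow> nat \<Rightarrow> nat \<Rightarrow> 'a \<Rightarrow> real"
    and S :: "nat \<Rightarrow> 'u measure"
    and U :: "nat \<Rightarrow> 'a \<Rightarrow> 'u"
    and \<pi> :: "nat \<Rightarrow> nat \<Rightarrow> 'a \<Rightarrow> nat"
    and istar :: "nat \<Rightarrow> nat"
    and \<Delta> :: "nat \<Rightarrow> real"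
    and frac :: "nat \<Rightarrow> 'a \<Rightarrow> real"
  defines "\<Delta> \<equiv> \<lambda>n. gap (P n)"
    and "frac \<equiv> \<lambda>n \<omega>. real (pulls (\<pi> n) (istar n) n \<omega>) / real n"
  assumes rho: "\<rho> > 1"
    and ucb: "\<And>n. canonical_ucb (M n) (P n) (X n) \<rho> (S n) (U n) (\<pi> n)"
    and istar: "\<And>n. is_arg_max (arm_mean (P n)) (\<lambda>i. i \<in> {1, 2}) (istar n)"
  shows
    "(\<Delta> \<in> \<omega>(\<lambda>n. sqrt (ln (real n) / real n)) \<longrightarrow> converges_in_prob M frac 1) \<and>
     (\<Delta> \<in> o(\<lambda>n. sqrt (ln (real n) / real n)) \<longrightarrow> converges_in_prob M frac (1 / 2)) \<and>
     (\<forall>\<theta>\<ge>0. (\<lambda>n. \<Delta> n * sqrt (real n / ln (real n))) \<longlonglongrightarrow> sqrt \<theta> \<longrightarrow>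
        converges_in_prob M frac (lambda_star \<rho> \<theta>)) \<and>
     (\<forall>\<theta>\<ge>0. \<exists>!l. l \<in> {0<..<1} \<and> lambda_eq \<rho> \<theta> l) \<and>
     strict_mono_on {0..} (lambda_star \<rho>) \<and>
     lambda_star \<rho> 0 = 1 / 2 \<and>
     (lambda_star \<rho> \<longlongrightarrow> 1) at_top"
proof -
  \<comment> \<open>The other arm, as the arms are 1 and 2.\<close>
  define jstar where "jstar = (\<lambda>n. 3 - istar n)"
  have \<rho>: "\<rho> > 0" using rho by simp
  have arms: "istar n \<in> {1, 2}" "jstar n \<in> {1, 2}" "istar n \<noteq> jstar n" "jstar n \<noteq> istar n" for n
    using istar[of n] by (auto simp: is_arg_max_def jstar_def)
  have \<Delta>: "arm_mean (P n) (istar n) - arm_mean (P n) (jstar n) = \<Delta> n"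
    "arm_mean (P n) (jstar n) - arm_mean (P n) (istar n) = - \<Delta> n" for n
    using istar[of n] by (auto simp: is_arg_max_def jstar_def \<Delta>_def gap_def not_less)
  define D where "D = (\<lambda>n. \<Delta> n * sqrt (real n / ln (real n)))"
  \<comment> \<open>For \<open>n \<le> 1\<close> both sides are 0, by the convention that division
    by 0 gives 0.\<close>
  have D_eq: "D n = \<Delta> n / sqrt (ln (real n) / real n)" for n
    by (simp add: D_def real_sqrt_divide)
  have optimal: "(\<lambda>n. measure (M n) {\<omega> \<in> space (M n). real (pulls (\<pi> n) (istar n) n \<omega>) > a * real n}) \<longlonglongrightarrow> 0"
    if "0 < a" "a < 1" "eventually (\<lambda>n. D n \<le> s) sequentially"
      "s + sqrt \<rho> / sqrt a < sqrt \<rho> / sqrt (1 - a)" for a s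
    using prob_pulls_tendsto_0[OF \<rho> ucb arms(1,2,3) that(1) _ that(4,2)] that(3)
    by (simp add: \<Delta> D_def)
  have suboptimal: "(\<lambda>n. measure (M n) {\<omega> \<in> space (M n). real (pulls (\<pi> n) (jstar n) n \<omega>) > a * real n}) \<longlonglongrightarrow> 0"
    if "0 < a" "a < 1" "eventually (\<lambda>n. - D n \<le> s) sequentially"
      "s + sqrt \<rho> / sqrt a < sqrt \<rho> / sqrt (1 - a)" for a s
    using prob_pulls_tendsto_0[OF \<rho> ucb arms(2,1,4) that(1) _ that(4,2)] that(3)
    by (simp add: \<Delta> D_def)
  have moderate: "converges_in_prob M frac (lambda_star \<rho> \<theta>)"
    if \<theta>: "\<theta> \<ge> 0" and lim: "D \<longlonglongrightarrow> sqrt \<theta>" for \<theta>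
    unfolding frac_def
  proof (rule pulls_frac_converges_in_prob[OF ucb arms(1,2,3)])
    note l = lambda_star_props(1,2)[OF \<rho> \<theta>]
    then show "0 \<le> lambda_star \<rho> \<theta>" "lambda_star \<rho> \<theta> \<le> 1" by auto
    fix a :: real
    {
      assume a: "lambda_star \<rho> \<theta> < a" "a < 1"
      then have "sqrt (\<theta> / \<rho>) < 1 / sqrt (1 - a) - 1 / sqrt a"
        using lambda_star_less_iff[OF \<rho> \<theta>, of a] l by auto
      then have "sqrt \<rho> * sqrt (\<theta> / \<rho>) < sqrt \<rho> * (1 / sqrt (1 - a) - 1 / sqrt a)"
        using \<rho> by (intro mult_strict_left_mono) auto
      then have "sqrt \<theta> < sqrt \<rho> / sqrt (1 - a) - sqrt \<rho> / sqrt a"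
        using \<rho> by (simp add: real_sqrt_divide right_diff_distrib)
      \<comment> \<open>A value strictly between the limit of \<open>D\<close> and the critical
        level: \<open>D\<close> is eventually below it, and it satisfies the strict inequality
        required of \<open>s\<close>.\<close>
      then obtain s where s: "sqrt \<theta> < s" "s < sqrt \<rho> / sqrt (1 - a) - sqrt \<rho> / sqrt a"
        using dense by blast
      show "(\<lambda>n. measure (M n) {\<omega> \<in> space (M n). real (pulls (\<pi> n) (istar n) n \<omega>) > a * real n}) \<longlonglongrightarrow> 0"
        using a l s eventually_mono[OF order_tendstoD(2)[OF lim s(1)] less_imp_le]
        by (intro optimal[of a s]) auto
    next
      assume a: "1 - lambda_star \<rho> \<theta> < a" "a < 1"
      \<comment> \<open>A suboptimal fraction above \<open>a\<close> means an optimal one below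
        \<open>1 - a\<close>, and \<open>1 - a\<close> lies below the root. The comparison is
        therefore made at \<open>1 - a\<close>, which swaps the two square roots.\<close>
      then have "1 / sqrt a - 1 / sqrt (1 - a) < sqrt (\<theta> / \<rho>)"
        using less_lambda_star_iff[OF \<rho> \<theta>, of "1 - a"] l by auto
      then have "sqrt \<rho> * (1 / sqrt a - 1 / sqrt (1 - a)) < sqrt \<rho> * sqrt (\<theta> / \<rho>)"
        using \<rho> by (intro mult_strict_left_mono) auto
      then have "sqrt \<rho> / sqrt a - sqrt \<rho> / sqrt (1 - a) < sqrt \<theta>"
        using \<rho> by (simp add: real_sqrt_divide right_diff_distrib)
      then obtain s where s: "sqrt \<rho> / sqrt a - sqrt \<rho> / sqrt (1 - a) < s" "s < sqrt \<theta>"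
        using dense by blast
      show "(\<lambda>n. measure (M n) {\<omega> \<in> space (M n). real (pulls (\<pi> n) (jstar n) n \<omega>) > a * real n}) \<longlonglongrightarrow> 0"
        using a l s eventually_mono[OF order_tendstoD(1)[OF lim s(2)] less_imp_le]
        by (intro suboptimal[of a "- s"]) auto
    }
  qed
  have large: "converges_in_prob M frac 1" if "\<Delta> \<in> \<omega>(\<lambda>n. sqrt (ln (real n) / real n))"
    unfolding frac_def
  proof (rule pulls_frac_converges_in_prob[OF ucb arms(1,2,3)])
    fix a :: real assume a: "1 - 1 < a" "a < 1"
    \<comment> \<open>With this \<open>s\<close> the required inequality reads
      \<open>0 < sqrt \<rho> / sqrt (1 - a)\<close>, true for every \<open>a\<close> in (0, 1). As
      the rescaled gap exceeds every constant eventually, no positive fraction of suboptimal pulls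
      survives. The upper condition is vacuous for \<open>c = 1\<close>.\<close>
    define s where "s = - (sqrt \<rho> / sqrt a)"
    have "0 < - s" using a \<rho> by (simp add: s_def)
    have "eventually (\<lambda>n. - D n \<le> s) sequentially"
      using landau_omega.smallD[OF that \<open>0 < - s\<close>] eventually_ge_at_top[of 2]
    proof eventually_elim
      case (elim n)
      have "sqrt (ln (real n) / real n) > 0" using elim(2) by simp
      moreover have "\<Delta> n \<ge> 0" by (simp add: \<Delta>_def gap_def)
      ultimately have "- s \<le> D n"
        using elim(1) a \<rho> by (simp add: D_eq pos_le_divide_eq s_def del: real_sqrt_gt_0_iff)
      then show ?case by simp
    qed
    then show "(\<lambda>n. measure (M n) {\<omega> \<in> space (M n). real (pulls (\<pi> n) (jstar n) n \<omega>) > a * real n}) \<longlonglongrightarrow> 0"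
      by (rule suboptimal[rotated 2]) (use a \<rho> in \<open>auto simp: s_def\<close>)
  qed auto
  have small: "converges_in_prob M frac (1 / 2)" if "\<Delta> \<in> o(\<lambda>n. sqrt (ln (real n) / real n))"
  proof -
    \<comment> \<open>The small gap is the moderate gap with \<theta> = 0, where the root is
      \<open>1 / 2\<close>.\<close>
    have "(\<lambda>n. \<Delta> n / sqrt (ln (real n) / real n)) \<longlonglongrightarrow> 0" using that by (rule smalloD_tendsto)
    then have "D \<longlonglongrightarrow> sqrt 0" by (simp add: D_eq[abs_def])
    from moderate[OF _ this] show ?thesis by (simp add: lambda_star_0[OF \<rho>])
  qed
  show ?thesis
    using large small moderate lambda_eq_ex1[OF \<rho>] strict_mono_on_lambda_star[OF \<rho>]
      lambda_star_0[OF \<rho>] tendsto_lambda_star_at_top[OF \<rho>]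
    unfolding D_def by blast
qed

end
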